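(* Fix an integer $k\ge 3$ and a constant $0<q<\tfrac12$, so that the gap $c=\tfrac12-q$ is a constant in $(0,\tfrac12)$. In the noisy $k$-group query model described in the context, there exists a polynomial-time algorithm that performs $O\!\left(n^{1+\frac{1}{\log\log n}}\log n\right)$ edge queries and, with high probability, recovers the $k$ clusters, i.e. correctly determines for every pair of items $u,v\in[n]$ whether $g(u)=g(v)$.
   Context: Noisy $k$-group query model: there are $n$ items $[n]$ and an unknown assignment $g:[n]\to\{0,1,\dots,k-1\}$ of items to $k$ groups, with group numbers regarded modulo $k$. Querying a pair $e=(x,y)$ returns a value $\tilde f(e)\in\{0,\dots,k-1\}$ where, independently for each queried pair, $\tilde f(e)=g(x)-g(y)\bmod k$ with probability $1-q$, $\tilde f(e)=g(x)-g(y)+1 \bmod k$ with probability $q/2$, and $\tilde f(e)=g(x)-g(y)-1\bmod k$ with probability $q/2$. "With high probability" means with probability tending to $1$ as $n\to\infty$. *)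

theory Defs
  imports "HOL-Probability.Probability" "HOL-Library.Landau_Symbols"
    "HOL-Computational_Algebra.Polynomial"
begin

section \<open>Query programs\<close>

text \<open>
  Algorithms are programs of a randomised random access machine with an edge-query oracle. A program
  is a finite object that does not depend on the number of items, which it receives in register 0.
  It uses finitely many registers and arrays, which are indexed by constants of the program text and
  hold natural numbers of arbitrary size. Every executed command, including every evaluation of the
  test of a conditional or loop, costs one step. The only arithmetic is addition and truncated
  subtraction, so the length of the numbers grows only linearly in the number of steps, and the unit
  cost measure is polynomially related to Turing machine time. There is deliberately no
  multiplication: at unit cost it would break that relationship.
\<close>

datatype expr =
    Const nat
  | Reg nat
  | Elem nat expr
  | Add expr expr
  | Sub expr expr

datatype com =
    Skip
  | Assign nat expr
  | Store nat expr expr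
  | Query nat expr expr
  | Flip nat
  | Seq com com
  | If expr com com
  | While expr com

record state =
  reg :: "nat \<Rightarrow> nat"
  arr :: "nat \<Rightarrow> nat \<Rightarrow> nat"
  flips :: nat
  queries :: nat
  steps :: nat

fun eval_expr :: "expr \<Rightarrow> state \<Rightarrow> nat" where
  "eval_expr (Const c) s = c"
| "eval_expr (Reg r) s = reg s r"
| "eval_expr (Elem a e) s = arr s a (eval_expr e s)"
| "eval_expr (Add e1 e2) s = eval_expr e1 s + eval_expr e2 s"
| "eval_expr (Sub e1 e2) s = eval_expr e1 s - eval_expr e2 s"

definition tick :: "state \<Rightarrow> state" where
  "tick s = s\<lparr>steps := Suc (steps s)\<rparr>"

definition set_reg :: "nat \<Rightarrow> nat \<Rightarrow> state \<Rightarrow> state" where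
  "set_reg r v s = s\<lparr>reg := (reg s)(r := v)\<rparr>"

definition set_arr :: "nat \<Rightarrow> nat \<Rightarrow> nat \<Rightarrow> state \<Rightarrow> state" where
  "set_arr a i v s = s\<lparr>arr := (arr s)(a := (arr s a)(i := v))\<rparr>"

text \<open>
  Big-step semantics, relative to the answers \<open>f x y\<close> to the queries and a tape \<open>\<omega>\<close> of coin flips.
  A program terminates iff it is related to some final state. Every execution of a query command is
  counted, also when a pair is queried again.
\<close>

inductive exec :: "(nat \<Rightarrow> nat \<Rightarrow> nat) \<Rightarrow> (nat \<Rightarrow> bool) \<Rightarrow> com \<Rightarrow> state \<Rightarrow> state \<Rightarrow> bool"
  for f :: "nat \<Rightarrow> nat \<Rightarrow> nat" and \<omega> :: "nat \<Rightarrow> bool" where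
  Skip: "exec f \<omega> Skip s (tick s)"
| Assign: "exec f \<omega> (Assign r e) s (tick (set_reg r (eval_expr e s) s))"
| Store: "exec f \<omega> (Store a e1 e2) s (tick (set_arr a (eval_expr e1 s) (eval_expr e2 s) s))"
| Query: "exec f \<omega> (Query r e1 e2) s
    (tick (set_reg r (f (eval_expr e1 s) (eval_expr e2 s)) (s\<lparr>queries := Suc (queries s)\<rparr>)))"
| Flip: "exec f \<omega> (Flip r) s
    (tick (set_reg r (of_bool (\<omega> (flips s))) (s\<lparr>flips := Suc (flips s)\<rparr>)))"
| Seq: "exec f \<omega> c1 s s' \<Longrightarrow> exec f \<omega> c2 s' s'' \<Longrightarrow> exec f \<omega> (Seq c1 c2) s s''"
| IfTrue: "eval_expr e s \<noteq> 0 \<Longrightarrow> exec f \<omega> c1 (tick s) s' \<Longrightarrow> exec f \<omega> (If e c1 c2) s s'"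
| IfFalse: "eval_expr e s = 0 \<Longrightarrow> exec f \<omega> c2 (tick s) s' \<Longrightarrow> exec f \<omega> (If e c1 c2) s s'"
| WhileFalse: "eval_expr e s = 0 \<Longrightarrow> exec f \<omega> (While e c) s (tick s)"
| WhileTrue: "eval_expr e s \<noteq> 0 \<Longrightarrow> exec f \<omega> c (tick s) s' \<Longrightarrow> exec f \<omega> (While e c) s' s''
    \<Longrightarrow> exec f \<omega> (While e c) s s''"

lemma exec_deterministic: "exec f \<omega> c s s1 \<Longrightarrow> exec f \<omega> c s s2 \<Longrightarrow> s2 = s1"
proof (induction arbitrary: s2 rule: exec.induct)
  case (Seq c1 s s' c2 s'')
  from Seq.prems obtain t where "exec f \<omega> c1 s t" "exec f \<omega> c2 t s2"
    by (cases rule: exec.cases) auto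
  with Seq.IH show ?case by simp
next
  case (IfTrue e s c1 s' c2)
  from IfTrue.prems IfTrue.hyps have "exec f \<omega> c1 (tick s) s2"
    by (cases rule: exec.cases) auto
  with IfTrue.IH show ?case by simp
next
  case (IfFalse e s c2 s' c1)
  from IfFalse.prems IfFalse.hyps have "exec f \<omega> c2 (tick s) s2"
    by (cases rule: exec.cases) auto
  with IfFalse.IH show ?case by simp
next
  case (WhileFalse e s c)
  from WhileFalse.prems WhileFalse.hyps show ?case
    by (cases rule: exec.cases) auto
next
  case (WhileTrue e s c s' s'')
  from WhileTrue.prems WhileTrue.hyps obtain t
    where "exec f \<omega> c (tick s) t" "exec f \<omega> (While e c) t s2"
    by (cases rule: exec.cases) auto
  with WhileTrue.IH show ?case by simp
qed (erule exec.cases; simp)+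

definition init_state :: "nat \<Rightarrow> state" where
  "init_state n = \<lparr>reg = (\<lambda>_. 0)(0 := n), arr = (\<lambda>_ _. 0), flips = 0, queries = 0, steps = 0\<rparr>"


section \<open>The noisy group query model\<close>

text \<open>The items are \<open>0, \<dots>, n - 1\<close>.\<close>

definition group_assignment :: "nat \<Rightarrow> nat \<Rightarrow> (nat \<Rightarrow> nat) \<Rightarrow> bool" where
  "group_assignment k n g \<longleftrightarrow> (\<forall>x<n. g x < k)"

definition edges :: "nat \<Rightarrow> (nat \<times> nat) set" where
  "edges n = {(x, y). x < y \<and> y < n}"

definition edge_noise :: "real \<Rightarrow> int pmf" where
  "edge_noise q = do {
     wrong \<leftarrow> bernoulli_pmf q;
     up \<leftarrow> bernoulli_pmf (1/2);
     return_pmf (if wrong then if up then 1 else -1 else 0)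
   }"

lemma pmf_edge_noise:
  assumes "0 \<le> q" "q \<le> 1"
  shows "pmf (edge_noise q) 0 = 1 - q" "pmf (edge_noise q) 1 = q / 2"
    "pmf (edge_noise q) (-1) = q / 2"
  using assms by (simp_all add: edge_noise_def pmf_bind indicator_def)

definition noise :: "nat \<Rightarrow> real \<Rightarrow> (nat \<times> nat \<Rightarrow> int) pmf" where
  "noise n q = Pi_pmf (edges n) 0 (\<lambda>_. edge_noise q)"

text \<open>
  There is one noise value per unordered pair of items: querying a pair again returns the same
  answer, and querying it in the opposite order returns the negated answer modulo \<open>k\<close>. Since the
  noise is symmetric, the answer to a query has the same law in both orders. Queries that are not
  pairs of distinct items return 0 and hence no information.
\<close>

definition answer :: "nat \<Rightarrow> nat \<Rightarrow> (nat \<Rightarrow> nat) \<Rightarrow> (nat \<times> nat \<Rightarrow> int) \<Rightarrow> nat \<Rightarrow> nat \<Rightarrow> nat" where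
  "answer k n g \<eta> x y =
    (if (x, y) \<in> edges n then nat ((int (g x) - int (g y) + \<eta> (x, y)) mod int k)
     else if (y, x) \<in> edges n then nat ((int (g x) - int (g y) - \<eta> (y, x)) mod int k)
     else 0)"

definition coin_space :: "(nat \<Rightarrow> bool) measure" where
  "coin_space = PiM UNIV (\<lambda>_. measure_pmf (bernoulli_pmf (1/2)))"


section \<open>Performance of a program\<close>

definition run :: "nat \<Rightarrow> com \<Rightarrow> nat \<Rightarrow> (nat \<Rightarrow> nat) \<Rightarrow> (nat \<times> nat \<Rightarrow> int) \<Rightarrow> (nat \<Rightarrow> bool) \<Rightarrow> state \<Rightarrow> bool"
  where "run k A n g \<eta> \<omega> s \<longleftrightarrow> exec (answer k n g \<eta>) \<omega> A (init_state n) s"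

text \<open>Both resource bounds are worst-case: over assignments, noise outcomes and coin flips.\<close>

definition polynomial_time :: "nat \<Rightarrow> real \<Rightarrow> com \<Rightarrow> bool" where
  "polynomial_time k q A \<longleftrightarrow>
    (\<exists>p :: nat poly. \<forall>n g \<eta> \<omega>. group_assignment k n g \<longrightarrow> \<eta> \<in> set_pmf (noise n q) \<longrightarrow>
       (\<exists>s. run k A n g \<eta> \<omega> s \<and> steps s \<le> poly p n))"

definition query_bound :: "nat \<Rightarrow> real \<Rightarrow> com \<Rightarrow> (nat \<Rightarrow> nat) \<Rightarrow> bool" where
  "query_bound k q A Q \<longleftrightarrow>
    (\<forall>n g \<eta> \<omega>. group_assignment k n g \<longrightarrow> \<eta> \<in> set_pmf (noise n q) \<longrightarrow>
       (\<exists>s. run k A n g \<eta> \<omega> s \<and> queries s \<le> Q n))"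

text \<open>The output is a cluster label for every item, in array 0; the names of the labels are irrelevant.\<close>

definition correct_output :: "nat \<Rightarrow> (nat \<Rightarrow> nat) \<Rightarrow> state \<Rightarrow> bool" where
  "correct_output n g s \<longleftrightarrow> (\<forall>u<n. \<forall>v<n. arr s 0 u = arr s 0 v \<longleftrightarrow> g u = g v)"

definition success_prob :: "nat \<Rightarrow> real \<Rightarrow> com \<Rightarrow> nat \<Rightarrow> (nat \<Rightarrow> nat) \<Rightarrow> real" where
  "success_prob k q A n g =
    measure (measure_pmf (noise n q) \<Otimes>\<^sub>M coin_space)
      {(\<eta>, \<omega>). \<exists>s. run k A n g \<eta> \<omega> s \<and> correct_output n g s}"

end

theory Submission
  imports Defs "HOL-Real_Asymp.Real_Asymp"
begin

text \<open>
  Every item is compared with the same \<open>m \<approx> (log\<^sub>2 n)\<^sup>2\<close> reference items, which costs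
  \<open>n m\<close> queries. For items \<open>u \<noteq> v\<close>, the events that the answers for \<open>(u, s)\<close> and \<open>(v, s)\<close> agree are
  independent over the reference items \<open>s\<close> other than \<open>u\<close> and \<open>v\<close>. Since \<open>k \<ge> 3\<close>, each of them has
  probability at least \<open>(1 - q)\<^sup>2 + q\<^sup>2 / 2\<close> if \<open>u\<close> and \<open>v\<close> are in the same group and at most
  \<open>q (1 - q) + q\<^sup>2 / 4\<close> otherwise, and \<open>q < 1/2\<close> separates these two values by a rational threshold.
  Comparing the number of agreements with the threshold is wrong with probability at most
  \<open>exp (- c m)\<close> by Hoeffding's inequality, and \<open>n\<^sup>2 exp (- c m)\<close> tends to 0. As
  \<open>n powr (1 / ln (ln n))\<close> grows faster than every power of \<open>ln n\<close>, the number of queries is small enough.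
\<close>

section \<open>Total correctness of query programs\<close>

text \<open>As \<open>exec\<close> is deterministic, the existence of one final state satisfying
  \<open>P\<close> is total correctness. The counters belong to the state, so \<open>P\<close> can
  also bound queries and steps.\<close>

definition wp :: "(nat \<Rightarrow> nat \<Rightarrow> nat) \<Rightarrow> (nat \<Rightarrow> bool) \<Rightarrow> com \<Rightarrow> (state \<Rightarrow> bool) \<Rightarrow> state \<Rightarrow> bool" where
  "wp f \<omega> c P s \<longleftrightarrow> (\<exists>s'. exec f \<omega> c s s' \<and> P s')"

inductive_cases SeqE: "exec f \<omega> (Seq c1 c2) s s'"

lemma wp_simps [simp]:
  "wp f \<omega> Skip P s \<longleftrightarrow> P (tick s)"
  "wp f \<omega> (Assign r e) P s \<longleftrightarrow> P (tick (set_reg r (eval_expr e s) s))"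
  "wp f \<omega> (Store a e1 e2) P s \<longleftrightarrow> P (tick (set_arr a (eval_expr e1 s) (eval_expr e2 s) s))"
  "wp f \<omega> (Query r e1 e2) P s \<longleftrightarrow> P (tick (set_reg r (f (eval_expr e1 s) (eval_expr e2 s))
     (s\<lparr>queries := Suc (queries s)\<rparr>)))"
  "wp f \<omega> (Seq c1 c2) P s \<longleftrightarrow> wp f \<omega> c1 (wp f \<omega> c2 P) s"
  "wp f \<omega> (If e c1 c2) P s \<longleftrightarrow> (if eval_expr e s \<noteq> 0 then wp f \<omega> c1 P (tick s) else wp f \<omega> c2 P (tick s))"
  unfolding wp_def by (auto elim: exec.cases intro: exec.intros elim!: SeqE)

lemma wp_mono: "wp f \<omega> c P s \<Longrightarrow> (\<And>s'. P s' \<Longrightarrow> P' s') \<Longrightarrow> wp f \<omega> c P' s"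
  unfolding wp_def by blast

text \<open>The invariant is indexed by the number of completed iterations and \<open>N\<close> is
  their exact total. This gives termination by induction on \<open>N - i\<close> and lets
  \<open>I\<close> record exact costs.\<close>

lemma wp_While:
  assumes "I 0 s"
    and step: "\<And>i s. i < N \<Longrightarrow> I i s \<Longrightarrow> eval_expr e s \<noteq> 0 \<and> wp f \<omega> c (I (Suc i)) (tick s)"
    and exit: "\<And>s. I N s \<Longrightarrow> eval_expr e s = 0 \<and> P (tick s)"
  shows "wp f \<omega> (While e c) P s"
proof -
  have "I i s \<Longrightarrow> i \<le> N \<Longrightarrow> wp f \<omega> (While e c) P s" for i s
  proof (induction "N - i" arbitrary: i s)
    case 0
    then show ?case using exit[of s] unfolding wp_def by (auto intro: exec.intros)
  next
    case (Suc j)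
    then have i: "i < N" by simp
    from step[OF i Suc.prems(1)] obtain t where t: "eval_expr e s \<noteq> 0" "exec f \<omega> c (tick s) t" "I (Suc i) t"
      unfolding wp_def by blast
    have "wp f \<omega> (While e c) P t"
      using Suc.hyps(1)[of "Suc i" t] t(3) Suc.hyps(2) i by simp
    with t show ?case unfolding wp_def by (auto intro: exec.intros)
  qed
  from this[of 0 s] assms(1) show ?thesis by simp
qed

lemma frame_simps [simp]:
  "reg (tick s) = reg s" "arr (tick s) = arr s" "queries (tick s) = queries s"
  "steps (tick s) = Suc (steps s)"
  "reg (set_reg r v s) = (reg s)(r := v)" "arr (set_reg r v s) = arr s"
  "queries (set_reg r v s) = queries s" "steps (set_reg r v s) = steps s"
  "reg (set_arr a i v s) = reg s" "arr (set_arr a i v s) = (arr s)(a := (arr s a)(i := v))"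
  "queries (set_arr a i v s) = queries s" "steps (set_arr a i v s) = steps s"
  by (simp_all add: tick_def set_reg_def set_arr_def)

text \<open>The machine cannot multiply; products with the constants \<open>a\<close> and
  \<open>b\<close> of the program text are unrolled into additions.\<close>

fun times_expr :: "nat \<Rightarrow> expr \<Rightarrow> expr" where
  "times_expr 0 e = Const 0"
| "times_expr (Suc c) e = Add e (times_expr c e)"

lemma eval_times_expr [simp]: "eval_expr (times_expr c e) s = c * eval_expr e s"
  by (induction c) auto

section \<open>The clustering program\<close>

definition bitlen :: "nat \<Rightarrow> nat" where
  "bitlen n = (LEAST l. n < 2 ^ l)"

text \<open>With a square, \<open>exp (- c * num_refs n)\<close> beats \<open>n^2\<close> for every
  constant \<open>c > 0\<close>; a fixed multiple of the logarithm would have to be tuned to the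
  noise.\<close>

definition num_refs :: "nat \<Rightarrow> nat" where
  "num_refs n = bitlen n * bitlen n"

lemma less_two_power_bitlen: "n < 2 ^ bitlen n"
  unfolding bitlen_def by (rule LeastI[of _ n]) simp

lemma two_power_le_if_less_bitlen: "l < bitlen n \<Longrightarrow> 2 ^ l \<le> n"
  unfolding bitlen_def using not_less_Least not_less by blast

lemma bitlen_le: "bitlen n \<le> n"
  unfolding bitlen_def by (rule Least_le) simp

lemma num_refs_le: "num_refs n \<le> n * n"
  unfolding num_refs_def by (intro mult_mono bitlen_le) auto

text \<open>
  Registers: 0 holds the number of items, 3 the number of reference items, 4 and 7 the pair of items
  under consideration, 5 the reference item, 6 the write position, 8 and 9 the offsets of the two
  rows in array 1, which stores the answers, and 10 the number of agreements.
\<close>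

definition count_refs :: com where
  "count_refs =
    Seq (Assign 1 (Const 1))
    (While (Sub (Add (Reg 0) (Const 1)) (Reg 1))
      (Seq (Assign 3 (Add (Reg 3) (Add (Add (Reg 2) (Reg 2)) (Const 1))))
      (Seq (Assign 2 (Add (Reg 2) (Const 1)))
           (Assign 1 (Add (Reg 1) (Reg 1))))))"

definition query_row :: com where
  "query_row =
    While (Sub (Reg 3) (Reg 5))
      (Seq (Query 11 (Reg 4) (Reg 5))
      (Seq (Store 1 (Reg 6) (Reg 11))
      (Seq (Assign 6 (Add (Reg 6) (Const 1)))
           (Assign 5 (Add (Reg 5) (Const 1))))))"

definition query_all :: com where
  "query_all =
    While (Sub (Reg 0) (Reg 4))
      (Seq (Assign 5 (Const 0))
      (Seq query_row
           (Assign 4 (Add (Reg 4) (Const 1)))))"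

text \<open>With truncated subtraction, \<open>1 - ((x - y) + (y - x))\<close> is the indicator of
  \<open>x = y\<close>.\<close>

definition count_agree :: com where
  "count_agree =
    While (Sub (Reg 3) (Reg 5))
      (Seq (Assign 10 (Add (Reg 10) (Sub (Const 1)
             (Add (Sub (Elem 1 (Add (Reg 8) (Reg 5))) (Elem 1 (Add (Reg 9) (Reg 5))))
                  (Sub (Elem 1 (Add (Reg 9) (Reg 5))) (Elem 1 (Add (Reg 8) (Reg 5))))))))
           (Assign 5 (Add (Reg 5) (Const 1))))"

text \<open>The conditional tests whether the fraction of agreements exceeds \<open>a / b\<close>,
  cross-multiplied to avoid division. Row offsets advance by repeated addition.\<close>

definition compare_all :: "nat \<Rightarrow> nat \<Rightarrow> com" where
  "compare_all a b =
    While (Sub (Reg 0) (Reg 7))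
      (Seq (Assign 5 (Const 0))
      (Seq (Assign 10 (Const 0))
      (Seq count_agree
      (Seq (If (Sub (times_expr b (Reg 10)) (times_expr a (Reg 3))) (Store 0 (Reg 7) (Reg 4)) Skip)
      (Seq (Assign 9 (Add (Reg 9) (Reg 3)))
           (Assign 7 (Add (Reg 7) (Const 1))))))))"

definition label_all :: "nat \<Rightarrow> nat \<Rightarrow> com" where
  "label_all a b =
    Seq (Assign 4 (Const 0))
    (While (Sub (Reg 0) (Reg 4))
      (Seq (Assign 7 (Const 0))
      (Seq (Assign 9 (Const 0))
      (Seq (compare_all a b)
      (Seq (Assign 8 (Add (Reg 8) (Reg 3)))
           (Assign 4 (Add (Reg 4) (Const 1))))))))"

definition cluster_com :: "nat \<Rightarrow> nat \<Rightarrow> com" where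
  "cluster_com a b = Seq count_refs (Seq query_all (label_all a b))"

section \<open>Functional specification and cost of the program\<close>

definition agreements :: "(nat \<Rightarrow> nat \<Rightarrow> nat) \<Rightarrow> nat \<Rightarrow> nat \<Rightarrow> nat \<Rightarrow> nat" where
  "agreements f m u v = (\<Sum>s<m. of_bool (f u s = f v s))"

definition similar :: "nat \<Rightarrow> nat \<Rightarrow> (nat \<Rightarrow> nat \<Rightarrow> nat) \<Rightarrow> nat \<Rightarrow> nat \<Rightarrow> nat \<Rightarrow> bool" where
  "similar a b f m u v \<longleftrightarrow> a * m < b * agreements f m u v"

text \<open>Later items overwrite the labels written by earlier ones, so the final label of
  \<open>v\<close> is the largest item similar to \<open>v\<close>; 0 is the initial content of the
  array.\<close>

fun last_similar :: "nat \<Rightarrow> nat \<Rightarrow> (nat \<Rightarrow> nat \<Rightarrow> nat) \<Rightarrow> nat \<Rightarrow> nat \<Rightarrow> nat \<Rightarrow> nat" where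
  "last_similar a b f m v 0 = 0"
| "last_similar a b f m v (Suc u) = (if similar a b f m u v then u else last_similar a b f m v u)"

text \<open>Register 1 runs through the powers of two until it exceeds \<open>n\<close>, which takes
  \<open>bitlen n\<close> rounds. Register 3 sums consecutive odd numbers and hence holds the square
  of the round number.\<close>

lemma wp_count_refs:
  "wp f \<omega> count_refs (\<lambda>s. reg s 0 = n \<and> reg s 3 = num_refs n \<and> reg s 4 = 0 \<and> reg s 6 = 0 \<and> reg s 8 = 0
     \<and> arr s 0 = (\<lambda>_. 0) \<and> queries s = 0 \<and> steps s \<le> 4 * n + 2) (init_state n)"
  unfolding count_refs_def wp_simps
  apply (rule wp_While[where N = "bitlen n" and I = "\<lambda>i s. reg s 0 = n \<and> reg s 1 = 2 ^ i \<and> reg s 2 = i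
     \<and> reg s 3 = i * i \<and> reg s 4 = 0 \<and> reg s 6 = 0 \<and> reg s 8 = 0
     \<and> arr s 0 = (\<lambda>_. 0) \<and> queries s = 0 \<and> steps s = 4 * i + 1"])
  subgoal by (simp add: init_state_def)
  subgoal for i s using two_power_le_if_less_bitlen[of i n] by (simp add: algebra_simps)
  subgoal for s using less_two_power_bitlen[of n] bitlen_le[of n] by (simp add: num_refs_def)
  done

lemma wp_query_row:
  assumes "reg s 5 = 0"
    and "\<And>t. \<lbrakk>\<And>r. r \<notin> {5, 6, 11} \<Longrightarrow> reg t r = reg s r; reg t 6 = reg s 6 + reg s 3;
      \<And>j. j < reg s 6 \<Longrightarrow> arr t 1 j = arr s 1 j; \<And>x. x < reg s 3 \<Longrightarrow> arr t 1 (reg s 6 + x) = f (reg s 4) x;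
      arr t 0 = arr s 0; queries t = queries s + reg s 3; steps t = steps s + 5 * reg s 3 + 1\<rbrakk> \<Longrightarrow> P t"
  shows "wp f \<omega> query_row P s"
  unfolding query_row_def
  apply (rule wp_While[where N = "reg s 3" and I = "\<lambda>i t. (\<forall>r. r \<notin> {5, 6, 11} \<longrightarrow> reg t r = reg s r)
     \<and> reg t 5 = i \<and> reg t 6 = reg s 6 + i
     \<and> (\<forall>j<reg s 6. arr t 1 j = arr s 1 j) \<and> (\<forall>x<i. arr t 1 (reg s 6 + x) = f (reg s 4) x)
     \<and> arr t 0 = arr s 0 \<and> queries t = queries s + i \<and> steps t = steps s + 5 * i"])
  subgoal using assms(1) by simp
  subgoal by (simp add: less_Suc_eq)
  subgoal by (auto intro!: assms(2))
  done

text \<open>The answers form a matrix stored row by row; writing row \<open>i\<close> leaves the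
  earlier rows intact.\<close>

lemma row_index_less: "u < i \<Longrightarrow> x < m \<Longrightarrow> u * m + x < i * (m :: nat)"
proof -
  assume "u < i" "x < m"
  then have "u * m + x < Suc u * m" by simp
  also have "\<dots> \<le> i * m" using \<open>u < i\<close> by (intro mult_right_mono) auto
  finally show ?thesis .
qed

lemma wp_query_all:
  assumes "reg s 4 = 0" "reg s 6 = 0"
    and "\<And>t. \<lbrakk>\<And>r. r \<notin> {4, 5, 6, 11} \<Longrightarrow> reg t r = reg s r;
      \<And>u x. u < reg s 0 \<Longrightarrow> x < reg s 3 \<Longrightarrow> arr t 1 (u * reg s 3 + x) = f u x;
      arr t 0 = arr s 0; queries t = queries s + reg s 0 * reg s 3;
      steps t = steps s + reg s 0 * (5 * reg s 3 + 4) + 1\<rbrakk> \<Longrightarrow> P t"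
  shows "wp f \<omega> query_all P s"
  unfolding query_all_def
  apply (rule wp_While[where N = "reg s 0" and I = "\<lambda>i t. (\<forall>r. r \<notin> {4, 5, 6, 11} \<longrightarrow> reg t r = reg s r)
     \<and> reg t 4 = i \<and> reg t 6 = i * reg s 3
     \<and> (\<forall>u<i. \<forall>x<reg s 3. arr t 1 (u * reg s 3 + x) = f u x)
     \<and> arr t 0 = arr s 0 \<and> queries t = queries s + i * reg s 3
     \<and> steps t = steps s + i * (5 * reg s 3 + 4)"])
  subgoal using assms(1,2) by simp
  subgoal for i t
    unfolding wp_simps
    apply (intro conjI)
    subgoal by simp
    apply (rule wp_query_row)
    subgoal by simp
    subgoal by (simp add: less_Suc_eq row_index_less algebra_simps) (metis row_index_less add.commute)
    done
  subgoal by (auto intro!: assms(3))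
  done

lemma wp_count_agree:
  assumes "reg s 5 = 0" "reg s 10 = 0"
    and F: "\<And>x. x < reg s 3 \<Longrightarrow> arr s 1 (reg s 8 + x) = f u x"
      "\<And>x. x < reg s 3 \<Longrightarrow> arr s 1 (reg s 9 + x) = f v x"
    and "\<And>t. \<lbrakk>\<And>r. r \<notin> {5, 10} \<Longrightarrow> reg t r = reg s r; reg t 10 = agreements f (reg s 3) u v;
      arr t = arr s; queries t = queries s; steps t = steps s + 3 * reg s 3 + 1\<rbrakk> \<Longrightarrow> P t"
  shows "wp f \<omega> count_agree P s"
  unfolding count_agree_def
  apply (rule wp_While[where N = "reg s 3" and I = "\<lambda>i t. (\<forall>r. r \<notin> {5, 10} \<longrightarrow> reg t r = reg s r)
     \<and> reg t 5 = i \<and> reg t 10 = agreements f i u v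
     \<and> arr t = arr s \<and> queries t = queries s \<and> steps t = steps s + 3 * i"])
  subgoal using assms(1,2) by (simp add: agreements_def)
  subgoal using F by (auto simp: agreements_def)
  subgoal by (auto intro!: assms(5))
  done

lemma wp_compare_all:
  assumes "reg s 7 = 0" "reg s 9 = 0" "reg s 4 < reg s 0" "reg s 8 = reg s 4 * reg s 3"
    and F: "\<And>u x. u < reg s 0 \<Longrightarrow> x < reg s 3 \<Longrightarrow> arr s 1 (u * reg s 3 + x) = f u x"
    and "\<And>t. \<lbrakk>\<And>r. r \<notin> {5, 7, 9, 10} \<Longrightarrow> reg t r = reg s r;
      \<And>v. v < reg s 0 \<Longrightarrow> arr t 0 v = (if similar a b f (reg s 3) (reg s 4) v then reg s 4 else arr s 0 v);
      arr t 1 = arr s 1; queries t = queries s;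
      steps t = steps s + reg s 0 * (3 * reg s 3 + 8) + 1\<rbrakk> \<Longrightarrow> P t"
  shows "wp f \<omega> (compare_all a b) P s"
  unfolding compare_all_def
  \<comment> \<open>The clause for \<open>v \<ge> i\<close> ensures that a dissimilar item keeps the
    label it had before the whole loop. \<open>Skip\<close> costs as much as \<open>Store\<close>,
    so the step count is exact.\<close>
  apply (rule wp_While[where N = "reg s 0" and I = "\<lambda>i t. (\<forall>r. r \<notin> {5, 7, 9, 10} \<longrightarrow> reg t r = reg s r)
     \<and> reg t 7 = i \<and> reg t 9 = i * reg s 3
     \<and> (\<forall>v<i. arr t 0 v = (if similar a b f (reg s 3) (reg s 4) v then reg s 4 else arr s 0 v))
     \<and> (\<forall>v\<ge>i. arr t 0 v = arr s 0 v)
     \<and> arr t 1 = arr s 1 \<and> queries t = queries s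
     \<and> steps t = steps s + i * (3 * reg s 3 + 8)"])
  subgoal using assms(1,2) by simp
  subgoal for i t
    unfolding wp_simps
    apply (intro conjI)
    subgoal by simp
    apply (rule wp_count_agree[where u = "reg s 4" and v = i])
    subgoal by simp
    subgoal by simp
    subgoal using F assms(3,4) by simp
    subgoal using F by simp
    subgoal by (auto simp: less_Suc_eq similar_def algebra_simps)
    done
  subgoal by (auto intro!: assms(6))
  done

lemma wp_label_all:
  assumes "reg s 8 = 0" "arr s 0 = (\<lambda>_. 0)"
    and F: "\<And>u x. u < reg s 0 \<Longrightarrow> x < reg s 3 \<Longrightarrow> arr s 1 (u * reg s 3 + x) = f u x"
    and "\<And>t. \<lbrakk>\<And>v. v < reg s 0 \<Longrightarrow> arr t 0 v = last_similar a b f (reg s 3) v (reg s 0);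
      queries t = queries s;
      steps t = steps s + reg s 0 * (reg s 0 * (3 * reg s 3 + 8) + 6) + 2\<rbrakk> \<Longrightarrow> P t"
  shows "wp f \<omega> (label_all a b) P s"
  unfolding label_all_def wp_simps
  apply (rule wp_While[where N = "reg s 0" and I = "\<lambda>i t. reg t 0 = reg s 0 \<and> reg t 3 = reg s 3
     \<and> reg t 4 = i \<and> reg t 8 = i * reg s 3
     \<and> (\<forall>v<reg s 0. arr t 0 v = last_similar a b f (reg s 3) v i)
     \<and> arr t 1 = arr s 1 \<and> queries t = queries s
     \<and> steps t = steps s + i * (reg s 0 * (3 * reg s 3 + 8) + 6) + 1"])
  subgoal using assms(1,2) by simp
  subgoal for i t
    unfolding wp_simps
    apply (intro conjI)
    subgoal by simp
    apply (rule wp_compare_all)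
    subgoal by simp
    subgoal by simp
    subgoal by simp
    subgoal by simp
    subgoal using F by simp
    subgoal by (simp add: algebra_simps)
    done
  subgoal by (auto intro!: assms(4))
  done

text \<open>The coefficients come from adding up the costs of the three phases with
  \<open>n * n\<close> in place of the number of reference items.\<close>

definition cluster_time :: "nat poly" where
  "cluster_time = [:5, 14, 8, 5, 3:]"

lemma steps_le_cluster_time:
  assumes "m \<le> n * n" "t \<le> 4 * n + 2"
  shows "t + n * (5 * m + 4) + 1 + n * (n * (3 * m + 8) + 6) + 2 \<le> poly cluster_time n"
proof -
  have "t + n * (5 * m + 4) + 1 + n * (n * (3 * m + 8) + 6) + 2
      \<le> (4 * n + 2) + n * (5 * (n * n) + 4) + 1 + n * (n * (3 * (n * n) + 8) + 6) + 2"
    using assms by (intro add_le_mono mult_le_mono order_refl)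
  then show ?thesis by (simp add: cluster_time_def algebra_simps)
qed

lemma wp_cluster_com:
  "wp f \<omega> (cluster_com a b) (\<lambda>s. (\<forall>v<n. arr s 0 v = last_similar a b f (num_refs n) v n)
     \<and> queries s = n * num_refs n \<and> steps s \<le> poly cluster_time n) (init_state n)"
  unfolding cluster_com_def wp_simps
  apply (rule wp_mono[OF wp_count_refs])
  apply (rule wp_query_all)
  subgoal by simp
  subgoal by simp
  apply (rule wp_label_all)
  subgoal by simp
  subgoal by simp
  subgoal by simp
  subgoal using steps_le_cluster_time num_refs_le by simp
  done

lemma run_cluster_com:
  "\<exists>s. run k (cluster_com a b) n g \<eta> \<omega> s
     \<and> (\<forall>v<n. arr s 0 v = last_similar a b (answer k n g \<eta>) (num_refs n) v n)
     \<and> queries s = n * num_refs n \<and> steps s \<le> poly cluster_time n"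
  using wp_cluster_com[of "answer k n g \<eta>" \<omega> a b n] unfolding run_def wp_def by blast

section \<open>Agreement of two noisy answers\<close>

definition item_edge :: "nat \<Rightarrow> nat \<Rightarrow> nat \<times> nat" where
  "item_edge u s = (min u s, max u s)"

text \<open>The noise of a pair is stored with the smaller item first; this is the sign with which
  it enters the answer for \<open>(u, s)\<close>.\<close>

definition orient :: "nat \<Rightarrow> nat \<Rightarrow> int" where
  "orient u s = (if u < s then 1 else -1)"

lemma item_edge_in_edges: "u < n \<Longrightarrow> s < n \<Longrightarrow> u \<noteq> s \<Longrightarrow> item_edge u s \<in> edges n"
  by (auto simp: item_edge_def edges_def min_def max_def)

lemma item_edge_eq_iff: "item_edge u s = item_edge v t \<longleftrightarrow> u = v \<and> s = t \<or> u = t \<and> s = v"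
  by (auto simp: item_edge_def min_def max_def split: if_splits)

lemma answer_eq:
  assumes "u < n" "s < n" "u \<noteq> s"
  shows "answer k n g \<eta> u s = nat ((int (g u) - int (g s) + orient u s * \<eta> (item_edge u s)) mod int k)"
  using assms by (auto simp: answer_def edges_def orient_def item_edge_def min_def max_def)

text \<open>The group of the reference item \<open>s\<close> cancels, leaving only the difference of
  the groups of \<open>u\<close> and \<open>v\<close> and two noise values.\<close>

lemma answers_agree_iff:
  assumes "u < n" "v < n" "s < n" "s \<noteq> u" "s \<noteq> v" "0 < k"
  shows "answer k n g \<eta> u s = answer k n g \<eta> v s \<longleftrightarrow>
    int k dvd int (g u) - int (g v) + orient u s * \<eta> (item_edge u s) - orient v s * \<eta> (item_edge v s)"
proof -
  have "answer k n g \<eta> u s = answer k n g \<eta> v s \<longleftrightarrow>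
    (int (g u) - int (g s) + orient u s * \<eta> (item_edge u s)) mod int k =
    (int (g v) - int (g s) + orient v s * \<eta> (item_edge v s)) mod int k"
    using assms by (simp add: answer_eq eq_nat_nat_iff)
  then show ?thesis by (simp add: mod_eq_dvd_iff algebra_simps)
qed

lemma finite_edges: "finite (edges n)"
  by (rule finite_subset[of _ "{..<n} \<times> {..<n}"]) (auto simp: edges_def)

lemma set_edge_noise: "set_pmf (edge_noise q) \<subseteq> {-1, 0, 1}"
  by (auto simp: edge_noise_def split: if_splits)

text \<open>Negation exchanges the two outcomes of the fair coin that chooses the sign. Thus the
  orientation of a query does not affect the law of its noise.\<close>

lemma map_uminus_edge_noise: "map_pmf uminus (edge_noise q) = edge_noise q"
proof -
  have *: "bernoulli_pmf (1/2) = map_pmf Not (bernoulli_pmf (1/2))"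
  proof (rule pmf_eqI)
    fix b
    have "Not -` {b} = {\<not> b}" by auto
    then show "pmf (bernoulli_pmf (1/2)) b = pmf (map_pmf Not (bernoulli_pmf (1/2))) b"
      by (cases b) (simp_all add: pmf_map measure_pmf_single)
  qed
  show ?thesis
    unfolding edge_noise_def map_bind_pmf
    apply (subst (2) *)
    by (auto simp: bind_map_pmf map_bind_pmf intro!: bind_pmf_cong)
qed

lemma map_orient_edge_noise: "map_pmf (\<lambda>x. orient u s * x) (edge_noise q) = edge_noise q"
  using map_uminus_edge_noise[of q] by (auto simp: orient_def)

text \<open>Splitting the coordinate \<open>x\<close> off the product leaves an independent product
  that still contains \<open>y\<close>.\<close>

lemma map_pair_Pi_pmf:
  assumes "finite A" "x \<in> A" "y \<in> A" "x \<noteq> y"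
  shows "map_pmf (\<lambda>f. (f x, f y)) (Pi_pmf A d p) = pair_pmf (p x) (p y)"
proof -
  have A: "A = insert x (A - {x})" using assms by auto
  have "map_pmf (\<lambda>f. (f x, f y)) (Pi_pmf A d p) =
      map_pmf (apsnd (\<lambda>f. f y)) (pair_pmf (p x) (Pi_pmf (A - {x}) d p))"
    using assms by (subst A, subst Pi_pmf_insert) (auto simp: map_pmf_comp intro!: map_pmf_cong)
  also have "\<dots> = pair_pmf (p x) (map_pmf (\<lambda>f. f y) (Pi_pmf (A - {x}) d p))"
    by (simp add: pair_map_pmf2)
  also have "map_pmf (\<lambda>f. f y) (Pi_pmf (A - {x}) d p) = p y"
    using assms by (subst Pi_pmf_component) auto
  finally show ?thesis .
qed

lemma map_oriented_noise:
  assumes "e \<in> edges n" "e' \<in> edges n" "e \<noteq> e'"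
  shows "map_pmf (\<lambda>\<eta>. (orient u s * \<eta> e, orient v t * \<eta> e')) (noise n q) =
    pair_pmf (edge_noise q) (edge_noise q)"
proof -
  have "map_pmf (\<lambda>\<eta>. (orient u s * \<eta> e, orient v t * \<eta> e')) (noise n q) =
    map_pmf (\<lambda>(a, b). (orient u s * a, orient v t * b)) (map_pmf (\<lambda>\<eta>. (\<eta> e, \<eta> e')) (noise n q))"
    by (simp add: map_pmf_comp)
  also have "\<dots> = pair_pmf (edge_noise q) (edge_noise q)"
    unfolding noise_def using assms
    by (simp add: map_pair_Pi_pmf finite_edges map_pair map_orient_edge_noise)
  finally show ?thesis .
qed

text \<open>The nine outcomes are grouped by the number of perturbed answers. Keeping
  \<open>R\<close> arbitrary serves both equal and different groups.\<close>

lemma prob_pair_edge_noise: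
  assumes "0 < q" "q < 1/2"
  shows "measure_pmf.prob (pair_pmf (edge_noise q) (edge_noise q)) {(x, y). R x y} =
    (1 - q)\<^sup>2 * of_bool (R 0 0)
    + (1 - q) * (q / 2) * (of_bool (R 0 1) + of_bool (R 0 (-1)) + of_bool (R 1 0) + of_bool (R (-1) 0))
    + (q / 2)\<^sup>2 * (of_bool (R 1 1) + of_bool (R 1 (-1)) + of_bool (R (-1) 1) + of_bool (R (-1) (-1)))"
proof -
  let ?P = "pair_pmf (edge_noise q) (edge_noise q)"
  let ?B = "{-1, 0, 1} \<times> {-1, 0, 1} :: (int \<times> int) set"
  have "measure_pmf.prob ?P {(x, y). R x y} = measure_pmf.prob ?P ({(x, y). R x y} \<inter> ?B)"
    using set_edge_noise[of q] by (intro measure_prob_cong_0) (auto simp: pmf_pair pmf_eq_0_set_pmf)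
  also have "\<dots> = (\<Sum>p\<in>{(x, y). R x y} \<inter> ?B. pmf ?P p)"
    by (intro measure_measure_pmf_finite) auto
  also have "\<dots> = (\<Sum>p\<in>?B. pmf ?P p * of_bool (R (fst p) (snd p)))"
    by (intro sum.mono_neutral_cong_left) (auto simp: case_prod_beta)
  also have "\<dots> = (\<Sum>x\<in>{-1, 0, 1}. \<Sum>y\<in>{-1, 0, 1}. pmf (edge_noise q) x * pmf (edge_noise q) y * of_bool (R x y))"
    by (subst sum.cartesian_product) (auto simp: pmf_pair intro!: sum.cong)
  also have "\<dots> = (1 - q)\<^sup>2 * of_bool (R 0 0)
    + (1 - q) * (q / 2) * (of_bool (R 0 1) + of_bool (R 0 (-1)) + of_bool (R 1 0) + of_bool (R (-1) 0))
    + (q / 2)\<^sup>2 * (of_bool (R 1 1) + of_bool (R 1 (-1)) + of_bool (R (-1) 1) + of_bool (R (-1) (-1)))"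
    using assms by (simp add: pmf_edge_noise field_simps power2_eq_square)
  finally show ?thesis .
qed

text \<open>Equal noise values leave \<open>D\<close> unchanged, so \<open>(0, 0)\<close>,
  \<open>(1, 1)\<close> and \<open>(-1, -1)\<close> always agree; any further agreeing pairs only
  increase the probability.\<close>

lemma prob_agree_same:
  assumes "0 < q" "q < 1/2" "int k dvd D"
  shows "(1 - q)\<^sup>2 + q\<^sup>2 / 2 \<le>
    measure_pmf.prob (pair_pmf (edge_noise q) (edge_noise q)) {(x, y). int k dvd D + x - y}"
proof -
  have "(1 - q)\<^sup>2 + q\<^sup>2 / 2 = (1 - q)\<^sup>2 * 1 + (1 - q) * (q / 2) * 0 + (q / 2)\<^sup>2 * 2"
    by (simp add: power2_eq_square)
  also have "\<dots> \<le> measure_pmf.prob (pair_pmf (edge_noise q) (edge_noise q)) {(x, y). int k dvd D + x - y}"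
    unfolding prob_pair_edge_noise[OF assms(1,2)]
    using assms by (intro add_mono mult_left_mono) auto
  finally show ?thesis .
qed

text \<open>
  For every noise value on the first edge, at most one value on the second edge makes the answers
  agree, and conversely. Hence among the nine pairs of noise values at most three agree, and at most
  two of these involve an unperturbed answer, since \<open>(0, 0)\<close> is not among them.
\<close>
lemma prob_agree_different:
  assumes "0 < q" "q < 1/2" "3 \<le> k" "\<not> int k dvd D"
  shows "measure_pmf.prob (pair_pmf (edge_noise q) (edge_noise q)) {(x, y). int k dvd D + x - y}
    \<le> q * (1 - q) + q\<^sup>2 / 4"
proof -
  define R where "R x y \<longleftrightarrow> int k dvd D + x - y" for x y
  \<comment> \<open>Two noise values differ by at most 2, which is less than \<open>k\<close>; this
    is where \<open>3 \<le> k\<close> enters.\<close>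
  have uniq: False if "int k dvd z" "z \<noteq> 0" "\<bar>z\<bar> \<le> 2" for z
    using that assms(3) dvd_imp_le_int[of z "int k"] by auto
  have row: "y = y'" if "R x y" "R x y'" "\<bar>y\<bar> \<le> 1" "\<bar>y'\<bar> \<le> 1" for x y y'
    using dvd_diff[OF that(1,2)[unfolded R_def]] uniq[of "y' - y"] that by force
  have col: "x = x'" if "R x y" "R x' y" "\<bar>x\<bar> \<le> 1" "\<bar>x'\<bar> \<le> 1" for x x' y
    using dvd_diff[OF that(1,2)[unfolded R_def]] uniq[of "x - x'"] that by force
  define A :: real where "A = of_bool (R 0 1) + of_bool (R 0 (-1)) + of_bool (R 1 0) + of_bool (R (-1) 0)"
  define B :: real where "B = of_bool (R 1 1) + of_bool (R 1 (-1)) + of_bool (R (-1) 1) + of_bool (R (-1) (-1))"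
  have A: "A \<le> 2"
    using row[of 0 1 "-1"] col[of 1 0 "-1"] by (auto simp: A_def)
  have AB: "A + B \<le> 3"
    using row[of 0 1 "-1"] row[of 1 1 "-1"] row[of "-1" 1 "-1"] row[of 1 0 1] row[of 1 0 "-1"]
      row[of "-1" 0 1] row[of "-1" 0 "-1"] by (auto simp: A_def B_def)
  have le: "(q / 2)\<^sup>2 \<le> (1 - q) * (q / 2)"
    using assms by (simp add: power2_eq_square)
  \<comment> \<open>Rewriting in terms of \<open>A\<close> and \<open>A + B\<close> makes both
    coefficients nonnegative by \<open>le\<close>, so both counting bounds apply; the extreme case
    is \<open>A = 2\<close>, \<open>B = 1\<close>.\<close>
  have "measure_pmf.prob (pair_pmf (edge_noise q) (edge_noise q)) {(x, y). R x y} =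
      ((1 - q) * (q / 2) - (q / 2)\<^sup>2) * A + (q / 2)\<^sup>2 * (A + B)"
    unfolding prob_pair_edge_noise[OF assms(1,2)] A_def B_def
    using assms(4) by (simp add: R_def algebra_simps)
  also have "\<dots> \<le> ((1 - q) * (q / 2) - (q / 2)\<^sup>2) * 2 + (q / 2)\<^sup>2 * 3"
    using A AB le by (intro add_mono mult_left_mono) auto
  also have "\<dots> = q * (1 - q) + q\<^sup>2 / 4"
    by (simp add: field_simps power2_eq_square)
  finally show ?thesis by (simp add: R_def)
qed

text \<open>The agreement at \<open>s\<close> depends only on the edges from \<open>s\<close> to
  \<open>u\<close> and \<open>v\<close>. These edge sets are disjoint for distinct \<open>s\<close>
  outside \<open>{u, v}\<close>; the edge joining \<open>u\<close> and \<open>v\<close> would be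
  shared by \<open>s = u\<close> and \<open>s = v\<close>.\<close>

lemma indep_agreements:
  assumes "u < n" "v < n" "u \<noteq> v" "m \<le> n" "0 < k"
  shows "prob_space.indep_vars (measure_pmf (noise n q)) (\<lambda>_. borel)
    (\<lambda>s \<eta>. of_bool (answer k n g \<eta> u s = answer k n g \<eta> v s) :: real) ({..<m} - {u, v})"
proof -
  let ?K = "\<lambda>s. {item_edge u s, item_edge v s}"
  let ?I = "{..<m} - {u, v}"
  let ?Y = "\<lambda>s \<zeta>. of_bool (int k dvd int (g u) - int (g v) + orient u s * \<zeta> (item_edge u s)
    - orient v s * \<zeta> (item_edge v s)) :: real"
  have "prob_space.indep_vars (measure_pmf (noise n q)) (\<lambda>_. count_space UNIV) (\<lambda>e \<eta>. \<eta> e) (edges n)"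
    unfolding noise_def by (intro indep_vars_Pi_pmf finite_edges)
  then have "prob_space.indep_vars (measure_pmf (noise n q)) (\<lambda>s. PiM (?K s) (\<lambda>_. count_space UNIV))
      (\<lambda>s \<eta>. restrict (\<lambda>e. \<eta> e) (?K s)) ?I"
    apply (rule prob_space.indep_vars_restrict[OF prob_space_measure_pmf])
    using assms by (auto simp: item_edge_in_edges disjoint_family_on_def item_edge_eq_iff)
  then have "prob_space.indep_vars (measure_pmf (noise n q)) (\<lambda>_. borel)
      (\<lambda>s \<eta>. ?Y s (restrict (\<lambda>e. \<eta> e) (?K s))) ?I"
  proof (rule prob_space.indep_vars_compose2[OF prob_space_measure_pmf])
    fix s
    have [measurable]: "(\<lambda>\<zeta>. \<zeta> (item_edge u s)) \<in> PiM (?K s) (\<lambda>_. count_space UNIV) \<rightarrow>\<^sub>M count_space (UNIV :: int set)"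
      "(\<lambda>\<zeta>. \<zeta> (item_edge v s)) \<in> PiM (?K s) (\<lambda>_. count_space UNIV) \<rightarrow>\<^sub>M count_space (UNIV :: int set)"
      by (auto intro!: measurable_component_singleton)
    show "?Y s \<in> PiM (?K s) (\<lambda>_. count_space UNIV) \<rightarrow>\<^sub>M borel"
      by measurable
  qed
  then show ?thesis
    using assms
    by (subst prob_space.indep_vars_cong[OF prob_space_measure_pmf refl _ refl])
       (auto simp: answers_agree_iff fun_eq_iff)
qed

section \<open>Concentration of the number of agreements\<close>

lemma expectation_agree:
  assumes "u < n" "v < n" "u \<noteq> v" "s < n" "s \<noteq> u" "s \<noteq> v" "0 < k"
  shows "measure_pmf.expectation (noise n q) (\<lambda>\<eta>. of_bool (answer k n g \<eta> u s = answer k n g \<eta> v s) :: real) =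
    measure_pmf.prob (pair_pmf (edge_noise q) (edge_noise q)) {(x, y). int k dvd int (g u) - int (g v) + x - y}"
proof -
  let ?S = "{(x, y). int k dvd int (g u) - int (g v) + x - y}"
  have "measure_pmf.prob (pair_pmf (edge_noise q) (edge_noise q)) ?S =
    measure_pmf.prob (noise n q) {\<eta>. answer k n g \<eta> u s = answer k n g \<eta> v s}"
    using assms
    by (subst map_oriented_noise[of "item_edge u s" n "item_edge v s" u s v s, symmetric])
       (auto simp: item_edge_in_edges item_edge_eq_iff answers_agree_iff vimage_def)
  also have "\<dots> = measure_pmf.expectation (noise n q) (indicator {\<eta>. answer k n g \<eta> u s = answer k n g \<eta> v s})"
    by simp
  also have "indicator {\<eta>. answer k n g \<eta> u s = answer k n g \<eta> v s} =
      (\<lambda>\<eta>. of_bool (answer k n g \<eta> u s = answer k n g \<eta> v s) :: real)"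
    by (auto simp: indicator_def)
  finally show ?thesis ..
qed

text \<open>The terms for \<open>u\<close> and \<open>v\<close> themselves are excluded, since querying an item with itself returns 0.\<close>
lemma agreements_bounds:
  "(\<Sum>s\<in>{..<m} - {u, v}. of_bool (f u s = f v s)) \<le> real (agreements f m u v)"
  "real (agreements f m u v) \<le> (\<Sum>s\<in>{..<m} - {u, v}. of_bool (f u s = f v s)) + 2"
proof -
  let ?X = "\<lambda>s. of_bool (f u s = f v s) :: real"
  have "real (agreements f m u v) = (\<Sum>s\<in>{..<m}. ?X s)"
    by (simp add: agreements_def)
  also have "\<dots> = (\<Sum>s\<in>{..<m} - {u, v}. ?X s) + (\<Sum>s\<in>{..<m} \<inter> {u, v}. ?X s)"
    by (subst sum.Int_Diff[of _ _ "{u, v}"]) auto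
  finally have eq: "real (agreements f m u v) =
      (\<Sum>s\<in>{..<m} - {u, v}. ?X s) + (\<Sum>s\<in>{..<m} \<inter> {u, v}. ?X s)" .
  have "(\<Sum>s\<in>{..<m} \<inter> {u, v}. ?X s) \<le> (\<Sum>s\<in>{u, v}. ?X s)"
    by (intro sum_mono2) auto
  also have "\<dots> \<le> (\<Sum>s\<in>{u, v}. 1)"
    by (intro sum_mono) auto
  also have "\<dots> \<le> 2"
    by (cases "u = v") auto
  finally show "real (agreements f m u v) \<le> (\<Sum>s\<in>{..<m} - {u, v}. ?X s) + 2"
    using eq by simp
  show "(\<Sum>s\<in>{..<m} - {u, v}. ?X s) \<le> real (agreements f m u v)"
    using eq by (simp add: sum_nonneg)
qed

lemma card_refs_bounds:
  "real (card ({..<m} - {u, v})) \<le> real m" "real m - 2 \<le> real (card ({..<m} - {u, v}))"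
proof -
  show "real (card ({..<m} - {u, v})) \<le> real m"
    using card_mono[of "{..<m}" "{..<m} - {u, v}"] by auto
  have "card {u, v} \<le> 2"
    by (cases "u = v") auto
  then have "m - 2 \<le> card ({..<m} - {u, v})"
    using diff_card_le_card_Diff[of "{u, v}" "{..<m}"] by simp
  then show "real m - 2 \<le> real (card ({..<m} - {u, v}))"
    by linarith
qed

text \<open>The threshold is at distance at least \<open>\<delta> * m\<close> from
  \<open>P * m\<close>. Excluding \<open>u\<close> and \<open>v\<close> costs at most 2, which
  \<open>4 \<le> \<delta> * m\<close> bounds by \<open>\<delta> * m / 2\<close>. So an error forces
  a deviation of \<open>\<delta> * m / 2\<close> from the mean, and Hoeffding's inequality
  applies.\<close>

lemma prob_similar_wrong:
  fixes a b :: nat and q \<delta> :: real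
  assumes q: "0 < q" "q < 1/2" and k: "3 \<le> k" and g: "group_assignment k n g"
    and uv: "u < n" "v < n" "u \<noteq> v" and m: "m \<le> n" "4 \<le> \<delta> * m" and \<delta>: "0 < \<delta>" "\<delta> \<le> 1"
    and b: "0 < b" and ab: "q * (1 - q) + q\<^sup>2 / 4 + \<delta> \<le> a / b" "a / b \<le> (1 - q)\<^sup>2 + q\<^sup>2 / 2 - \<delta>"
  shows "measure_pmf.prob (noise n q) {\<eta>. similar a b (answer k n g \<eta>) m u v \<noteq> (g u = g v)}
    \<le> exp (- (\<delta>\<^sup>2 / 2) * m)"
proof -
  let ?T = "{..<m} - {u, v}"
  let ?N = "real (card ?T)"
  let ?X = "\<lambda>s \<eta>. of_bool (answer k n g \<eta> u s = answer k n g \<eta> v s) :: real"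
  define P where "P = measure_pmf.prob (pair_pmf (edge_noise q) (edge_noise q))
      {(x, y). int k dvd int (g u) - int (g v) + x - y}"
  have P1: "P \<le> 1"
    unfolding P_def by simp
  have P0: "0 \<le> P"
    unfolding P_def by simp
  \<comment> \<open>Both group numbers are below \<open>k\<close>, so congruence modulo
    \<open>k\<close> is equality.\<close>
  have dvd: "int k dvd int (g u) - int (g v) \<longleftrightarrow> g u = g v"
  proof -
    have "g u < k" "g v < k"
      using g uv by (auto simp: group_assignment_def)
    then show ?thesis
      by (auto dest!: zdvd_imp_le[rotated] simp: mod_eq_dvd_iff[symmetric])
  qed
  interpret Hoeffding_ineq "measure_pmf (noise n q)" ?T ?X "\<lambda>_. 0" "\<lambda>_. 1" "\<Sum>s\<in>?T. measure_pmf.expectation (noise n q) (?X s)"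
    using indep_agreements[of u n v m k q g] uv m k
    by unfold_locales auto
  have mu: "(\<Sum>s\<in>?T. measure_pmf.expectation (noise n q) (?X s)) = ?N * P"
    using uv m k by (simp add: expectation_agree P_def)
  have m4: "4 \<le> real m"
    using m(2) \<delta> mult_right_mono[of \<delta> 1 "real m"] by linarith
  then have N: "0 < ?N"
    using card_refs_bounds(2)[of m u v] by linarith
  have exp_le: "exp (-2 * (\<delta> * m / 2)\<^sup>2 / (\<Sum>s\<in>?T. (1 - 0)\<^sup>2)) \<le> exp (- (\<delta>\<^sup>2 / 2) * m)"
  proof -
    have "(\<delta>\<^sup>2 / 2) * m * ?N \<le> (\<delta>\<^sup>2 / 2) * m * m"
      using card_refs_bounds(1)[of m u v] by (intro mult_left_mono) auto
    then have "(\<delta>\<^sup>2 / 2) * m \<le> 2 * (\<delta> * m / 2)\<^sup>2 / ?N"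
      using N by (simp add: field_simps power2_eq_square)
    then show ?thesis by simp
  qed
  have sim: "similar a b (answer k n g \<eta>) m u v \<longleftrightarrow> a / b * m < agreements (answer k n g \<eta>) m u v" for \<eta>
    using b unfolding similar_def by (simp add: field_simps flip: of_nat_mult)
  show ?thesis
  proof (cases "g u = g v")
    case True
    then have P: "a / b \<le> P - \<delta>"
      using prob_agree_same[OF q, of k "int (g u) - int (g v)"] dvd ab(2) by (simp add: P_def)
    have "{\<eta>. similar a b (answer k n g \<eta>) m u v \<noteq> (g u = g v)} \<subseteq>
      {\<eta> \<in> space (measure_pmf (noise n q)). (\<Sum>s\<in>?T. ?X s \<eta>) \<le>
        (\<Sum>s\<in>?T. measure_pmf.expectation (noise n q) (?X s)) - \<delta> * m / 2}"
    proof
      fix \<eta> assume "\<eta> \<in> {\<eta>. similar a b (answer k n g \<eta>) m u v \<noteq> (g u = g v)}"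
      then have "agreements (answer k n g \<eta>) m u v \<le> a / b * m"
        using True sim by auto
      also have "\<dots> \<le> (P - \<delta>) * m"
        using P by (intro mult_right_mono) auto
      finally have "(\<Sum>s\<in>?T. ?X s \<eta>) \<le> (P - \<delta>) * m"
        using agreements_bounds(1)[where f = "answer k n g \<eta>"] by (rule order_trans[rotated])
      \<comment> \<open>At most two summands are missing, and \<open>P \<le> 1\<close>, so the mean
        is at least \<open>P * m - 2\<close>.\<close>
      moreover have "P * (real m - 2) \<le> P * ?N"
        using card_refs_bounds(2) P0 by (intro mult_left_mono)
      ultimately have "(\<Sum>s\<in>?T. ?X s \<eta>) \<le> (\<Sum>s\<in>?T. measure_pmf.expectation (noise n q) (?X s)) - \<delta> * m / 2"
        unfolding mu using m(2) P1 by (simp add: algebra_simps)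
      then show "\<eta> \<in> {\<eta> \<in> space (measure_pmf (noise n q)). (\<Sum>s\<in>?T. ?X s \<eta>) \<le>
          (\<Sum>s\<in>?T. measure_pmf.expectation (noise n q) (?X s)) - \<delta> * m / 2}"
        by simp
    qed
    then have "measure_pmf.prob (noise n q) {\<eta>. similar a b (answer k n g \<eta>) m u v \<noteq> (g u = g v)} \<le>
      measure_pmf.prob (noise n q) {\<eta> \<in> space (measure_pmf (noise n q)). (\<Sum>s\<in>?T. ?X s \<eta>) \<le>
        (\<Sum>s\<in>?T. measure_pmf.expectation (noise n q) (?X s)) - \<delta> * m / 2}"
      by (intro measure_pmf.finite_measure_mono) auto
    also have "\<dots> \<le> exp (-2 * (\<delta> * m / 2)\<^sup>2 / (\<Sum>s\<in>?T. (1 - 0)\<^sup>2))"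
      using \<delta> N by (intro Hoeffding_ineq_le) auto
    also note exp_le
    finally show ?thesis .
  next
    case False
    then have P: "P + \<delta> \<le> a / b"
      using prob_agree_different[OF q k, of "int (g u) - int (g v)"] dvd ab(1) by (simp add: P_def)
    have "{\<eta>. similar a b (answer k n g \<eta>) m u v \<noteq> (g u = g v)} \<subseteq>
      {\<eta> \<in> space (measure_pmf (noise n q)). (\<Sum>s\<in>?T. ?X s \<eta>) \<ge>
        (\<Sum>s\<in>?T. measure_pmf.expectation (noise n q) (?X s)) + \<delta> * m / 2}"
    proof
      fix \<eta> assume "\<eta> \<in> {\<eta>. similar a b (answer k n g \<eta>) m u v \<noteq> (g u = g v)}"
      then have "a / b * m \<le> agreements (answer k n g \<eta>) m u v"
        using False sim by auto
      moreover have "(P + \<delta>) * m \<le> a / b * m"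
        using P by (intro mult_right_mono) auto
      ultimately have "(P + \<delta>) * m \<le> (\<Sum>s\<in>?T. ?X s \<eta>) + 2"
        using agreements_bounds(2)[of "answer k n g \<eta>" m u v] by linarith
      moreover have "P * ?N \<le> P * real m"
        using card_refs_bounds(1) P0 by (intro mult_left_mono)
      ultimately have "(\<Sum>s\<in>?T. measure_pmf.expectation (noise n q) (?X s)) + \<delta> * m / 2 \<le> (\<Sum>s\<in>?T. ?X s \<eta>)"
        unfolding mu using m(2) by (simp add: algebra_simps)
      then show "\<eta> \<in> {\<eta> \<in> space (measure_pmf (noise n q)). (\<Sum>s\<in>?T. ?X s \<eta>) \<ge>
          (\<Sum>s\<in>?T. measure_pmf.expectation (noise n q) (?X s)) + \<delta> * m / 2}"
        by simp
    qed
    then have "measure_pmf.prob (noise n q) {\<eta>. similar a b (answer k n g \<eta>) m u v \<noteq> (g u = g v)} \<le>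
      measure_pmf.prob (noise n q) {\<eta> \<in> space (measure_pmf (noise n q)). (\<Sum>s\<in>?T. ?X s \<eta>) \<ge>
        (\<Sum>s\<in>?T. measure_pmf.expectation (noise n q) (?X s)) + \<delta> * m / 2}"
      by (intro measure_pmf.finite_measure_mono) auto
    also have "\<dots> \<le> exp (-2 * (\<delta> * m / 2)\<^sup>2 / (\<Sum>s\<in>?T. (1 - 0)\<^sup>2))"
      using \<delta> N by (intro Hoeffding_ineq_ge) auto
    also note exp_le
    finally show ?thesis .
  qed
qed

section \<open>From pairwise decisions to cluster labels\<close>

lemma last_similar_cong:
  "(\<And>u. u < n \<Longrightarrow> similar a b f m u v \<longleftrightarrow> similar a b f m u w) \<Longrightarrow>
    last_similar a b f m v n = last_similar a b f m w n"
  by (induction n) auto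

lemma similar_last_similar:
  "u < n \<Longrightarrow> similar a b f m u v \<Longrightarrow> similar a b f m (last_similar a b f m v n) v \<and> last_similar a b f m v n < n"
  by (induction n) (auto simp: less_Suc_eq)

text \<open>Items of one group are similar to the same items and so get the same label. Conversely,
  \<open>v\<close> is similar to itself, so its label is an item of its own group and never merely
  the default 0.\<close>

lemma last_similar_eq_iff:
  assumes "\<And>u v. u < n \<Longrightarrow> v < n \<Longrightarrow> similar a b f m u v \<longleftrightarrow> g u = g v" "v < n" "w < n"
  shows "last_similar a b f m v n = last_similar a b f m w n \<longleftrightarrow> g v = g w"
proof
  assume "g v = g w"
  with assms show "last_similar a b f m v n = last_similar a b f m w n"
    by (intro last_similar_cong) auto
next
  assume eq: "last_similar a b f m v n = last_similar a b f m w n"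
  have "g (last_similar a b f m x n) = g x" if "x < n" for x
    using similar_last_similar[of x n a b f m x] assms(1) that by auto
  from this[OF assms(2)] this[OF assms(3)] eq show "g v = g w"
    by simp
qed

text \<open>The diagonal case of the union bound: a row agrees with itself at all \<open>m\<close>
  positions, so no error is possible.\<close>

lemma similar_refl: "a < b \<Longrightarrow> 0 < m \<Longrightarrow> similar a b f m u u"
  by (simp add: similar_def agreements_def)

lemma prob_space_coin_space: "prob_space coin_space"
  unfolding coin_space_def by (intro prob_space_PiM prob_space_measure_pmf)

text \<open>The program flips no coins, so its success event is a set of noise outcomes times the
  whole coin space.\<close>

lemma success_prob_cluster_com:
  "success_prob k q (cluster_com a b) n g = measure_pmf.prob (noise n q)
    {\<eta>. \<forall>u<n. \<forall>v<n. last_similar a b (answer k n g \<eta>) (num_refs n) u n =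
      last_similar a b (answer k n g \<eta>) (num_refs n) v n \<longleftrightarrow> g u = g v}" (is "_ = measure_pmf.prob _ ?G")
proof -
  interpret C: prob_space coin_space
    by (rule prob_space_coin_space)
  have "(\<exists>s. run k (cluster_com a b) n g \<eta> \<omega> s \<and> correct_output n g s) \<longleftrightarrow> \<eta> \<in> ?G" for \<eta> \<omega>
  proof -
    obtain s where s: "run k (cluster_com a b) n g \<eta> \<omega> s"
      "\<forall>v<n. arr s 0 v = last_similar a b (answer k n g \<eta>) (num_refs n) v n"
      using run_cluster_com by blast
    have "t = s" if "run k (cluster_com a b) n g \<eta> \<omega> t" for t
      using exec_deterministic s(1) that unfolding run_def by blast
    then have "(\<exists>s. run k (cluster_com a b) n g \<eta> \<omega> s \<and> correct_output n g s) \<longleftrightarrow> correct_output n g s"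
      using s(1) by blast
    also have "\<dots> \<longleftrightarrow> \<eta> \<in> ?G"
      using s(2) by (auto simp: correct_output_def)
    finally show ?thesis .
  qed
  then have "{(\<eta>, \<omega>). \<exists>s. run k (cluster_com a b) n g \<eta> \<omega> s \<and> correct_output n g s} = ?G \<times> space coin_space"
    by (auto simp: coin_space_def space_PiM)
  then have "success_prob k q (cluster_com a b) n g =
      measure (measure_pmf (noise n q) \<Otimes>\<^sub>M coin_space) (?G \<times> space coin_space)"
    by (simp add: success_prob_def)
  also have "\<dots> = measure_pmf.prob (noise n q) ?G"
    unfolding measure_def by (subst C.emeasure_pair_measure_Times) (auto simp: C.emeasure_space_1)
  finally show ?thesis .
qed

text \<open>A wrong clustering requires a misjudged pair; the factor \<open>n^2\<close> is the union
  bound over all ordered pairs.\<close>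

lemma success_prob_cluster_com_ge:
  fixes a b :: nat and q \<delta> :: real
  assumes q: "0 < q" "q < 1/2" and k: "3 \<le> k" and g: "group_assignment k n g"
    and m: "num_refs n \<le> n" "4 \<le> \<delta> * num_refs n" and \<delta>: "0 < \<delta>" "\<delta> \<le> 1"
    and b: "0 < b" and ab: "q * (1 - q) + q\<^sup>2 / 4 + \<delta> \<le> a / b" "a / b \<le> (1 - q)\<^sup>2 + q\<^sup>2 / 2 - \<delta>"
  shows "1 - (real n)\<^sup>2 * exp (- (\<delta>\<^sup>2 / 2) * num_refs n) \<le> success_prob k q (cluster_com a b) n g"
proof -
  let ?m = "num_refs n"
  let ?W = "\<lambda>p. {\<eta>. similar a b (answer k n g \<eta>) ?m (fst p) (snd p) \<noteq> (g (fst p) = g (snd p))}"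
  let ?G = "{\<eta>. \<forall>u<n. \<forall>v<n. last_similar a b (answer k n g \<eta>) ?m u n =
      last_similar a b (answer k n g \<eta>) ?m v n \<longleftrightarrow> g u = g v}"
  have "(1 - q)\<^sup>2 + q\<^sup>2 / 2 < 1"
  proof -
    have "q * q < q * (1/2)" using q by (intro mult_strict_left_mono) auto
    then show ?thesis using q by (simp add: power2_eq_square algebra_simps)
  qed
  then have "a / b < 1"
    using ab(2) \<delta>(1) by linarith
  then have "a < b"
    using b by simp
  have "0 < ?m"
    using m(2) by (cases ?m) auto
  have W: "measure_pmf.prob (noise n q) (?W p) \<le> exp (- (\<delta>\<^sup>2 / 2) * ?m)" if "p \<in> {..<n} \<times> {..<n}" for p
  proof (cases "fst p = snd p")
    case True
    then show ?thesis using similar_refl[OF \<open>a < b\<close> \<open>0 < ?m\<close>] by simp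
  next
    case False
    then show ?thesis
      using that by (intro prob_similar_wrong[OF q k g _ _ _ m \<delta> b ab]) auto
  qed
  have "- ?G \<subseteq> (\<Union>p\<in>{..<n} \<times> {..<n}. ?W p)"
  proof
    fix \<eta> assume "\<eta> \<in> - ?G"
    then have "\<not> (\<forall>u<n. \<forall>v<n. similar a b (answer k n g \<eta>) ?m u v \<longleftrightarrow> g u = g v)"
      using last_similar_eq_iff[of n a b "answer k n g \<eta>" ?m g] by blast
    then show "\<eta> \<in> (\<Union>p\<in>{..<n} \<times> {..<n}. ?W p)"
      by auto
  qed
  then have "measure_pmf.prob (noise n q) (- ?G) \<le> measure_pmf.prob (noise n q) (\<Union>p\<in>{..<n} \<times> {..<n}. ?W p)"
    by (intro measure_pmf.finite_measure_mono) auto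
  also have "\<dots> \<le> (\<Sum>p\<in>{..<n} \<times> {..<n}. measure_pmf.prob (noise n q) (?W p))"
    by (intro measure_pmf.finite_measure_subadditive_finite) auto
  also have "\<dots> \<le> (\<Sum>p\<in>{..<n} \<times> {..<n}. exp (- (\<delta>\<^sup>2 / 2) * ?m))"
    by (intro sum_mono W)
  also have "\<dots> = (real n)\<^sup>2 * exp (- (\<delta>\<^sup>2 / 2) * ?m)"
    by (simp add: power2_eq_square)
  finally have "measure_pmf.prob (noise n q) (- ?G) \<le> (real n)\<^sup>2 * exp (- (\<delta>\<^sup>2 / 2) * ?m)" .
  moreover have "measure_pmf.prob (noise n q) (- ?G) = 1 - measure_pmf.prob (noise n q) ?G"
    using measure_pmf.prob_compl[of ?G "noise n q"] by (simp add: Compl_eq_Diff_UNIV)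
  ultimately show ?thesis
    unfolding success_prob_cluster_com by linarith
qed

section \<open>Asymptotics\<close>

lemma num_refs_ge: "0 < n \<Longrightarrow> (log 2 n)\<^sup>2 \<le> num_refs n"
proof -
  assume n: "0 < n"
  have "log 2 n \<le> bitlen n"
    using less_two_power_bitlen[of n] n by (intro log2_of_power_le) auto
  moreover have "0 \<le> log 2 n"
    using n by simp
  ultimately have "(log 2 n)\<^sup>2 \<le> (real (bitlen n))\<^sup>2"
    by (intro power_mono)
  then show ?thesis
    by (simp add: num_refs_def power2_eq_square)
qed

lemma num_refs_le_log: "0 < n \<Longrightarrow> num_refs n \<le> (log 2 n + 1)\<^sup>2"
proof -
  assume n: "0 < n"
  have "real (bitlen n) \<le> log 2 n + 1"
  proof (cases "bitlen n")
    case (Suc l)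
    then have "2 ^ l \<le> n"
      using two_power_le_if_less_bitlen[of l n] by simp
    then have "l \<le> log 2 n"
      using n by (intro le_log2_of_power) auto
    then show ?thesis using Suc by simp
  qed (use n in simp)
  then have "(real (bitlen n))\<^sup>2 \<le> (log 2 n + 1)\<^sup>2"
    by (intro power_mono) auto
  then show ?thesis
    by (simp add: num_refs_def power2_eq_square)
qed

lemma eventually_num_refs_le: "eventually (\<lambda>n. num_refs n \<le> n) at_top"
proof -
  have "eventually (\<lambda>n :: nat. (log 2 n + 1)\<^sup>2 \<le> n) at_top"
    by real_asymp
  then show ?thesis
    using eventually_gt_at_top[of 0]
  proof eventually_elim
    case (elim n)
    then show ?case using num_refs_le_log[of n] by simp
  qed
qed

lemma eventually_num_refs_ge: "0 < \<delta> \<Longrightarrow> eventually (\<lambda>n. 4 \<le> \<delta> * real (num_refs n)) at_top"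
proof -
  assume \<delta>: "0 < \<delta>"
  then have "eventually (\<lambda>n :: nat. 4 \<le> \<delta> * (log 2 n)\<^sup>2) at_top"
    by real_asymp
  then show ?thesis
    using eventually_gt_at_top[of 0]
  proof eventually_elim
    case (elim n)
    then show ?case
      using \<delta> num_refs_ge[of n] by (intro order_trans[OF elim(1) mult_left_mono]) auto
  qed
qed

text \<open>Here \<open>n^2\<close> is \<open>exp (2 * ln n)\<close>, whereas the negative exponent
  is quadratic in the logarithm.\<close>

lemma failure_bound_tendsto_0:
  fixes c :: real
  assumes "0 < c"
  shows "(\<lambda>n. (real n)\<^sup>2 * exp (- c * num_refs n)) \<longlonglongrightarrow> 0"
proof (rule tendsto_sandwich[of "\<lambda>_. 0"])
  show "eventually (\<lambda>n. (real n)\<^sup>2 * exp (- c * num_refs n) \<le> (real n)\<^sup>2 * exp (- c * (log 2 n)\<^sup>2)) at_top"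
    using eventually_gt_at_top[of 0]
  proof eventually_elim
    case (elim n)
    then show ?case
      using assms num_refs_ge[of n] by (intro mult_left_mono) auto
  qed
  show "(\<lambda>n. (real n)\<^sup>2 * exp (- c * (log 2 n)\<^sup>2)) \<longlonglongrightarrow> 0"
    using assms by real_asymp
qed auto

lemma queries_bigo:
  "(\<lambda>n. real (n * num_refs n)) \<in> O(\<lambda>n. real n powr (1 + 1 / ln (ln (real n))) * ln (real n))"
proof -
  have "(\<lambda>n. real (n * num_refs n)) \<in> O(\<lambda>n. real n * (log 2 n + 1)\<^sup>2)"
  proof (rule landau_o.big_mono)
    show "eventually (\<lambda>n. norm (real (n * num_refs n)) \<le> norm (real n * (log 2 n + 1)\<^sup>2)) at_top"
      using eventually_gt_at_top[of 0]
    proof eventually_elim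
      case (elim n)
      then show ?case using num_refs_le_log[of n] by (simp add: mult_left_mono)
    qed
  qed
  also have "(\<lambda>n. real n * (log 2 n + 1)\<^sup>2) \<in> O(\<lambda>n. real n powr (1 + 1 / ln (ln (real n))) * ln (real n))"
    by real_asymp
  finally show ?thesis .
qed

text \<open>The two agreement probabilities differ by
  \<open>(1 - q) * (1 - 2 * q) + q^2 / 4\<close>, which is positive. A rational number between them
  is chosen because the program compares integers.\<close>

lemma ex_threshold:
  fixes q :: real
  assumes "0 < q" "q < 1/2"
  obtains a b :: nat and \<delta> :: real where "0 < b" "0 < \<delta>" "\<delta> \<le> 1"
    "q * (1 - q) + q\<^sup>2 / 4 + \<delta> \<le> a / b" "a / b \<le> (1 - q)\<^sup>2 + q\<^sup>2 / 2 - \<delta>"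
proof -
  let ?lo = "q * (1 - q) + q\<^sup>2 / 4" and ?hi = "(1 - q)\<^sup>2 + q\<^sup>2 / 2"
  have "?hi - ?lo = (1 - q) * (1 - 2 * q) + q\<^sup>2 / 4"
    by (simp add: field_simps power2_eq_square)
  also have "\<dots> > 0"
    using assms by (intro add_pos_pos mult_pos_pos) auto
  finally have "?lo < ?hi" by simp
  then obtain r where r: "r \<in> \<rat>" "?lo < r" "r < ?hi"
    using Rats_dense_in_real by blast
  have "0 < ?lo" using assms by (intro add_pos_pos mult_pos_pos) auto
  with r have "0 < r" by linarith
  with r(1) obtain a b :: nat where ab: "b \<noteq> 0" "r = a / b"
    by (metis Rats_abs_nat_div_natE abs_of_pos)
  define \<delta> where "\<delta> = min 1 (min (r - ?lo) (?hi - r))"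
  show thesis
    by (rule that[of b \<delta> a]) (use r ab in \<open>auto simp: \<delta>_def\<close>)
qed

theorem theorem2:
  fixes k :: nat and q :: real
  assumes "3 \<le> k" and "0 < q" and "q < 1/2"
  shows "\<exists>A :: com.
    polynomial_time k q A \<and>
    (\<exists>Q :: nat \<Rightarrow> nat. query_bound k q A Q \<and>
       (\<lambda>n. real (Q n)) \<in> O(\<lambda>n. real n powr (1 + 1 / ln (ln (real n))) * ln (real n))) \<and>
    (\<forall>g :: nat \<Rightarrow> nat \<Rightarrow> nat. (\<forall>n. group_assignment k n (g n)) \<longrightarrow>
       (\<lambda>n. success_prob k q A n (g n)) \<longlonglongrightarrow> 1)"
proof -
  \<comment> \<open>The threshold depends on \<open>q\<close> alone, so one program text serves all
    \<open>n\<close>.\<close>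
  obtain a b :: nat and \<delta> where ab: "0 < b" "0 < \<delta>" "\<delta> \<le> 1"
    "q * (1 - q) + q\<^sup>2 / 4 + \<delta> \<le> a / b" "a / b \<le> (1 - q)\<^sup>2 + q\<^sup>2 / 2 - \<delta>"
    using ex_threshold assms(2,3) by metis
  have "polynomial_time k q (cluster_com a b)"
    unfolding polynomial_time_def using run_cluster_com by blast
  moreover have "query_bound k q (cluster_com a b) (\<lambda>n. n * num_refs n)"
    unfolding query_bound_def using run_cluster_com by (metis order_refl)
  moreover have "(\<lambda>n. success_prob k q (cluster_com a b) n (g n)) \<longlonglongrightarrow> 1"
    if g: "\<And>n. group_assignment k n (g n)" for g
  proof (rule tendsto_sandwich)
    show "eventually (\<lambda>n. 1 - (real n)\<^sup>2 * exp (- (\<delta>\<^sup>2 / 2) * num_refs n)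
        \<le> success_prob k q (cluster_com a b) n (g n)) at_top"
      using eventually_num_refs_le eventually_num_refs_ge[OF ab(2)]
    proof eventually_elim
      case (elim n)
      then show ?case
        using success_prob_cluster_com_ge[OF assms(2,3,1) g _ _ ab(2,3,1,4,5)] by blast
    qed
    show "(\<lambda>n. 1 - (real n)\<^sup>2 * exp (- (\<delta>\<^sup>2 / 2) * num_refs n)) \<longlonglongrightarrow> 1"
      using tendsto_diff[OF tendsto_const failure_bound_tendsto_0[of "\<delta>\<^sup>2 / 2"], of 1] ab(2) by simp
    show "eventually (\<lambda>n. success_prob k q (cluster_com a b) n (g n) \<le> 1) at_top"
      by (simp add: success_prob_cluster_com)
  qed auto
  ultimately show ?thesis
    using queries_bigo by blast
qed

end
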